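(* Let $R$ be a commutative ring and $n$ a positive integer. If $R$ is an $n$-SRC ring, then the matrix ring ${\mathbb M}_{n}(R)$ is strongly clean.
   Context: All rings are associative with identity; $U(R)$ is the group of units of $R$. An element $a$ of a ring $S$ is strongly clean if $a=e+u$ with $e^2=e\in S$, $u\in U(S)$ and $eu=ue$; $S$ is a strongly clean ring if every element of $S$ is strongly clean. Let $R$ be a commutative ring and $f(t)\in R[t]$ monic. An SR factorization of $f$ is a factorization $f(t)=f_0(t)f_1(t)$ in $R[t]$ with $f_0,f_1$ monic such that there are idempotents $e_0\neq e_1$ in $R$ with $f_0(e_0)\in U(R)$ and $f_1(e_1)\in U(R)$. It is an SRC factorization if, in addition, $(f_0,f_1)$ is unimodular, i.e. $f_0(t)R[t]+f_1(t)R[t]=R[t]$. (The factors are allowed to be equal to $1$.) $R$ is an $n$-SRC ring if every monic polynomial of degree $n$ in $R[t]$ has an SRC factorization. *)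

theory Defs
  imports
    "HOL-Computational_Algebra.Polynomial"
    "Jordan_Normal_Form.Matrix"
begin

definition strongly_clean_elem :: "('a, 'm) ring_scheme \<Rightarrow> 'a \<Rightarrow> bool" where
  "strongly_clean_elem S a \<longleftrightarrow>
     (\<exists>e \<in> carrier S. \<exists>u \<in> Units S.
        a = e \<oplus>\<^bsub>S\<^esub> u \<and> e \<otimes>\<^bsub>S\<^esub> e = e \<and> e \<otimes>\<^bsub>S\<^esub> u = u \<otimes>\<^bsub>S\<^esub> e)"

definition strongly_clean_ring :: "('a, 'm) ring_scheme \<Rightarrow> bool" where
  "strongly_clean_ring S \<longleftrightarrow> ring S \<and> (\<forall>a \<in> carrier S. strongly_clean_elem S a)"

definition SR_factorization ::
    "'a :: comm_ring_1 poly \<Rightarrow> 'a poly \<Rightarrow> 'a poly \<Rightarrow> bool" where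
  "SR_factorization f f0 f1 \<longleftrightarrow>
     f = f0 * f1 \<and> lead_coeff f0 = 1 \<and> lead_coeff f1 = 1 \<and>
     (\<exists>e0 e1. e0 * e0 = e0 \<and> e1 * e1 = e1 \<and> e0 \<noteq> e1 \<and>
        poly f0 e0 dvd 1 \<and> poly f1 e1 dvd 1)"

(* The library's coprime only says that all common divisors are units; over a general
   commutative ring this is weaker than the two elements generating the unit ideal. *)
definition unimodular_pair :: "'a :: comm_ring_1 \<Rightarrow> 'a \<Rightarrow> bool" where
  "unimodular_pair p q \<longleftrightarrow> {p * a + q * b | a b. True} = UNIV"

definition SRC_factorization ::
    "'a :: comm_ring_1 poly \<Rightarrow> 'a poly \<Rightarrow> 'a poly \<Rightarrow> bool" where
  "SRC_factorization f f0 f1 \<longleftrightarrow> SR_factorization f f0 f1 \<and> unimodular_pair f0 f1"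

definition SRC_ring :: "nat \<Rightarrow> 'a :: comm_ring_1 itself \<Rightarrow> bool" where
  "SRC_ring n R \<longleftrightarrow>
     (\<forall>f :: 'a poly. lead_coeff f = 1 \<and> degree f = n \<longrightarrow>
        (\<exists>f0 f1. SRC_factorization f f0 f1))"

end

theory Submission
  imports
    Defs
    "Jordan_Normal_Form.Char_Poly"
begin

text \<open>
  Let \<open>A\<close> be an \<open>n \<times> n\<close> matrix with characteristic polynomial \<open>f\<close>, and let \<open>f = f\<^sub>0 f\<^sub>1\<close> be an SRC
  factorization with idempotents \<open>e\<^sub>0, e\<^sub>1\<close>. By Cayley--Hamilton, evaluation at \<open>A\<close> is a ring
  homomorphism that factors through \<open>R[t]/(f)\<close>, so it is enough to write \<open>t\<close> as a sum of an
  idempotent and a unit modulo \<open>f\<close>: the images of the two summands are polynomials in \<open>A\<close> and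
  therefore commute.

  As \<open>(f\<^sub>0, f\<^sub>1)\<close> is unimodular, \<open>R[t]/(f)\<close> is the product of \<open>R[t]/(f\<^sub>0)\<close> and \<open>R[t]/(f\<^sub>1)\<close>, and the
  decomposition can be found in each factor separately. There it is \<open>t = e\<^sub>i + (t - e\<^sub>i)\<close>: since
  \<open>f\<^sub>i = (t - e\<^sub>i) q + f\<^sub>i(e\<^sub>i)\<close> with \<open>f\<^sub>i(e\<^sub>i)\<close> a unit of \<open>R\<close>, the element \<open>t - e\<^sub>i\<close> is a unit modulo \<open>f\<^sub>i\<close>
  (\<open>linear_unit_mod\<close>). The two decompositions are glued in \<open>idempotent_unit_sum_mod_prod\<close>.
\<close>

section \<open>An idempotent plus a unit modulo a product\<close>

lemma linear_unit_mod:
  fixes f :: "'a :: comm_ring_1 poly"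
  assumes "poly f c dvd 1"
  obtains w where "f dvd [:- c, 1:] * w - 1"
proof -
  obtain d where d: "poly f c * d = 1"
    using assms by (metis dvd_def)
  define q where "q = synthetic_div f c"
  have f: "f = [:- c, 1:] * q + [:poly f c:]"
    unfolding q_def by (rule synthetic_div_correct'[symmetric])
  have "[:poly f c:] * [:d:] = 1"
    using d by (simp add: one_pCons mult.commute)
  moreover have "f * [:- d:] = - ([:- c, 1:] * q * [:d:]) - [:poly f c:] * [:d:]"
  proof -
    have "f * [:- d:] = - (([:- c, 1:] * q + [:poly f c:]) * [:d:])"
      by (subst f[symmetric]) simp
    then show ?thesis
      by (simp only: distrib_right minus_add_distrib) simp
  qed
  ultimately have "[:- c, 1:] * (- q * [:d:]) - 1 = f * [:- d:]"
    by (simp add: mult.assoc)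
  then show thesis
    using that by (metis dvd_triv_left)
qed

text \<open>
  The elements \<open>f1 * b\<close> and \<open>f0 * a\<close> are the orthogonal idempotents of the Chinese remainder
  theorem: modulo \<open>f0\<close> they are \<open>1\<close> and \<open>0\<close>, modulo \<open>f1\<close> they are \<open>0\<close> and \<open>1\<close>. The summands and the
  inverse are assembled from their values in the two factors with these weights.
\<close>

lemma idempotent_unit_sum_mod_prod:
  fixes f0 f1 x :: "'a :: comm_ring_1"
  assumes uni: "f0 * a + f1 * b = 1"
    and idem: "e0 * e0 = e0" "e1 * e1 = e1"
    and inv: "f0 dvd (x - e0) * w0 - 1" "f1 dvd (x - e1) * w1 - 1"
  obtains e u v where "x = e + u" "f0 * f1 dvd e * e - e" "f0 * f1 dvd u * v - 1"
proof -
  obtain k0 where k0: "(x - e0) * w0 = 1 + f0 * k0"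
    using inv(1) by (metis dvdE diff_add_cancel add.commute)
  obtain k1 where k1: "(x - e1) * w1 = 1 + f1 * k1"
    using inv(2) by (metis dvdE diff_add_cancel add.commute)
  define p where "p = f0 * a"
  define q where "q = f1 * b"
  have q: "q = 1 - p"
    using uni by (simp add: p_def q_def algebra_simps)
  have pq: "p * q = f0 * f1 * (a * b)"
    by (simp add: p_def q_def)
  define e where "e = e0 * q + e1 * p"
  define u where "u = (x - e0) * q + (x - e1) * p"
  define v where "v = w0 * q + w1 * p"
  show thesis
  proof
    show "x = e + u"
      unfolding e_def u_def q by (simp add: algebra_simps)
    have "e * e - e = (e0 * e0) * (q * q) + (e1 * e1) * (p * p) + 2 * e0 * e1 * (p * q)
        - e0 * q - e1 * p"
      by (simp add: e_def algebra_simps)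
    also have "\<dots> = (2 * e0 * e1 - e0 - e1) * (p * q)"
      unfolding idem q by (simp add: algebra_simps)
    also have "\<dots> = f0 * f1 * ((2 * e0 * e1 - e0 - e1) * (a * b))"
      unfolding pq by (simp only: ac_simps)
    finally show "f0 * f1 dvd e * e - e"
      by simp
    have "u * v - 1 = ((x - e0) * w0) * (q * q) + ((x - e1) * w1) * (p * p)
        + ((x - e0) * w1 + (x - e1) * w0) * (p * q) - 1"
      by (simp add: u_def v_def algebra_simps)
    also have "\<dots> = (q * q + p * p - 1) + (f0 * k0) * (q * q) + (f1 * k1) * (p * p)
        + ((x - e0) * w1 + (x - e1) * w0) * (p * q)"
      unfolding k0 k1 by (simp add: algebra_simps)
    also have "q * q + p * p - 1 = - 2 * (p * q)"
      unfolding q by (simp add: algebra_simps)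
    also have "- 2 * (p * q) + (f0 * k0) * (q * q) + (f1 * k1) * (p * p)
        + ((x - e0) * w1 + (x - e1) * w0) * (p * q)
      = f0 * f1 * (- 2 * (a * b) + k0 * b * q + k1 * a * p
        + ((x - e0) * w1 + (x - e1) * w0) * (a * b))"
      unfolding pq by (simp add: p_def q_def algebra_simps)
    finally show "f0 * f1 dvd u * v - 1"
      by simp
  qed
qed

section \<open>Evaluating polynomials at a matrix\<close>

definition mat_eval :: "nat \<Rightarrow> 'a :: comm_ring_1 mat \<Rightarrow> 'a poly \<Rightarrow> 'a mat" where
  "mat_eval n A p = fold_coeffs (\<lambda>c M. c \<cdot>\<^sub>m 1\<^sub>m n + A * M) p (0\<^sub>m n n)"

context
  fixes n :: nat and A :: "'a :: comm_ring_1 mat"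
  assumes A: "A \<in> carrier_mat n n"
begin

lemma mat_eval_0: "mat_eval n A 0 = 0\<^sub>m n n"
  by (simp add: mat_eval_def)

lemma mat_eval_pCons: "mat_eval n A (pCons c p) = c \<cdot>\<^sub>m 1\<^sub>m n + A * mat_eval n A p"
proof (cases "c = 0 \<and> p = 0")
  case True
  then show ?thesis
    using A by (intro eq_matI) (auto simp: mat_eval_def)
next
  case False
  then show ?thesis
    by (auto simp: mat_eval_def)
qed

lemma mat_eval_closed: "mat_eval n A p \<in> carrier_mat n n"
  by (induction p) (use A in \<open>auto simp: mat_eval_0 mat_eval_pCons\<close>)

lemma mat_eval_1: "mat_eval n A 1 = 1\<^sub>m n"
  using A by (intro eq_matI) (auto simp: one_pCons mat_eval_pCons mat_eval_0)

lemma mat_eval_X: "mat_eval n A [:0, 1:] = A"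
  using A by (intro eq_matI) (auto simp: mat_eval_pCons mat_eval_0)

lemma mat_eval_const: "mat_eval n A [:c:] = c \<cdot>\<^sub>m 1\<^sub>m n"
  using A by (intro eq_matI) (auto simp: mat_eval_pCons mat_eval_0)

lemma mat_eval_add: "mat_eval n A (p + q) = mat_eval n A p + mat_eval n A q"
proof (induction p q rule: poly_induct2)
  case 0
  then show ?case
    by (simp add: mat_eval_0)
next
  case (pCons a p b q)
  have "A * (mat_eval n A p + mat_eval n A q) = A * mat_eval n A p + A * mat_eval n A q"
    by (rule mult_add_distrib_mat[OF A mat_eval_closed mat_eval_closed])
  then show ?case
    using A mat_eval_closed[of p] mat_eval_closed[of q] pCons.IH
    by (intro eq_matI) (auto simp: mat_eval_pCons algebra_simps)
qed

lemma mat_eval_smult: "mat_eval n A (Polynomial.smult c p) = c \<cdot>\<^sub>m mat_eval n A p"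
proof (induction p)
  case 0
  then show ?case
    by (auto simp: mat_eval_0)
next
  case (pCons a p)
  then show ?case
    using A mat_eval_closed[of p]
    by (intro eq_matI) (auto simp: mat_eval_pCons algebra_simps)
qed

lemma mat_eval_mult: "mat_eval n A (p * q) = mat_eval n A p * mat_eval n A q"
proof (induction p)
  case 0
  then show ?case
    using mat_eval_closed[of q] by (simp add: mat_eval_0)
next
  case (pCons a p)
  have "mat_eval n A (pCons a p * q) = a \<cdot>\<^sub>m mat_eval n A q + A * (mat_eval n A p * mat_eval n A q)"
    using A mat_eval_closed[of p] mat_eval_closed[of q]
    by (simp add: mat_eval_add mat_eval_smult mat_eval_pCons pCons.IH) (auto intro!: eq_matI)
  also have "\<dots> = (a \<cdot>\<^sub>m 1\<^sub>m n) * mat_eval n A q + A * mat_eval n A p * mat_eval n A q"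
    using A mat_eval_closed[of p] mat_eval_closed[of q]
    by (simp add: mult_smult_assoc_mat[of _ n n])
  also have "\<dots> = (a \<cdot>\<^sub>m 1\<^sub>m n + A * mat_eval n A p) * mat_eval n A q"
    using A mat_eval_closed[of p] mat_eval_closed[of q]
    by (intro add_mult_distrib_mat[symmetric]) auto
  finally show ?case
    by (simp add: mat_eval_pCons)
qed

lemma mat_eval_sum_index:
  assumes "i < n" "j < n"
  shows "mat_eval n A (\<Sum>k\<in>S. p k) $$ (i, j) = (\<Sum>k\<in>S. mat_eval n A (p k) $$ (i, j))"
proof (induction S rule: infinite_finite_induct)
  case (insert k S)
  then show ?case
    using assms mat_eval_closed[of "\<Sum>k\<in>S. p k"] by (auto simp: mat_eval_add)
qed (use assms in \<open>auto simp: mat_eval_0\<close>)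

text \<open>
  Let \<open>t\<close> act on \<open>R\<^sup>n\<close> as \<open>A\<close>, with standard basis \<open>\<epsilon>\<^sub>0, \<dots>, \<epsilon>\<^sub>n\<^sub>-\<^sub>1\<close>. The relations
  \<open>t \<epsilon>\<^sub>j = \<Sum>i<n. A\<^sub>i\<^sub>j \<epsilon>\<^sub>i\<close> say that the columns of the characteristic matrix \<open>C = t I - A\<close> lie in the
  kernel of the \<open>R[t]\<close>-linear map \<open>(p\<^sub>i) \<mapsto> \<Sum>i<n. p\<^sub>i(A) \<epsilon>\<^sub>i\<close>. Hence so do the columns of \<open>C adj(C)\<close>,
  which are the multiples of the unit vectors by the characteristic polynomial.
\<close>

theorem cayley_hamilton: "mat_eval n A (char_poly A) = 0\<^sub>m n n"
proof -
  define C where "C = char_poly_matrix A"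
  have C: "C \<in> carrier_mat n n"
    unfolding C_def using A by simp
  define B where "B = adj_mat C"
  have B: "B \<in> carrier_mat n n" and CB: "C * B = char_poly A \<cdot>\<^sub>m 1\<^sub>m n"
    unfolding B_def char_poly_def C_def[symmetric] using adj_mat[OF C] by auto
  note carr = mat_eval_closed
  have column: "(\<Sum>i<n. mat_eval n A (C $$ (i, j)) $$ (m, i)) = 0" if "m < n" "j < n" for m j
  proof -
    have "mat_eval n A (C $$ (i, j)) $$ (m, i)
        = (if i = j then A $$ (m, j) else 0) - (if i = m then A $$ (m, j) else 0)" if "i < n" for i
    proof -
      have "C $$ (i, j) = (if i = j then [:0, 1:] else 0) + [:- (A $$ (i, j)):]"
        using A \<open>i < n\<close> \<open>j < n\<close> by (auto simp: C_def char_poly_matrix_def)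
      moreover have "mat_eval n A (if i = j then [:0, 1:] else 0) $$ (m, i)
          = (if i = j then A $$ (m, j) else 0)"
        using \<open>i < n\<close> \<open>m < n\<close> by (simp add: mat_eval_X mat_eval_0)
      moreover have "mat_eval n A [:- (A $$ (i, j)):] $$ (m, i)
          = - (if i = m then A $$ (m, j) else 0)"
        using \<open>i < n\<close> \<open>m < n\<close> by (auto simp: mat_eval_const)
      ultimately show ?thesis
        using carr[of "[:- (A $$ (i, j)):]"] \<open>i < n\<close> \<open>m < n\<close> by (simp add: mat_eval_add)
    qed
    then have "(\<Sum>i<n. mat_eval n A (C $$ (i, j)) $$ (m, i))
        = (\<Sum>i<n. (if i = j then A $$ (m, j) else 0) - (if i = m then A $$ (m, j) else 0))"
      by (intro sum.cong) auto
    also have "\<dots> = 0"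
      using that by (simp add: sum_subtractf)
    finally show ?thesis .
  qed
  have "mat_eval n A (char_poly A) $$ (m, k) = 0" if m: "m < n" and k: "k < n" for m k
  proof -
    have entry: "(C * B) $$ (i, k) = (\<Sum>j<n. B $$ (j, k) * C $$ (i, j))" if "i < n" for i
      using B C k that
      by (auto simp: scalar_prod_def mult.commute atLeast0LessThan intro!: sum.cong)
    have prod: "mat_eval n A (p * q) $$ (m, i)
        = (\<Sum>l<n. mat_eval n A p $$ (m, l) * mat_eval n A q $$ (l, i))" if "i < n" for p q i
      using carr[of p] carr[of q] m that
      by (auto simp: mat_eval_mult scalar_prod_def atLeast0LessThan intro!: sum.cong)
    have "mat_eval n A (char_poly A) $$ (m, k)
        = (\<Sum>i<n. if i = k then mat_eval n A (char_poly A) $$ (m, i) else 0)"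
      using k by simp
    also have "\<dots> = (\<Sum>i<n. mat_eval n A ((C * B) $$ (i, k)) $$ (m, i))"
      unfolding CB using k m by (intro sum.cong) (auto simp: mat_eval_0)
    also have "\<dots> = (\<Sum>i<n. \<Sum>j<n. \<Sum>l<n.
        mat_eval n A (B $$ (j, k)) $$ (m, l) * mat_eval n A (C $$ (i, j)) $$ (l, i))"
      using m by (intro sum.cong) (auto simp: entry prod mat_eval_sum_index)
    also have "\<dots> = (\<Sum>j<n. \<Sum>l<n. mat_eval n A (B $$ (j, k)) $$ (m, l)
        * (\<Sum>i<n. mat_eval n A (C $$ (i, j)) $$ (l, i)))"
      unfolding sum_distrib_left
      by (rule trans[OF sum.swap]) (rule sum.cong[OF refl], rule sum.swap)
    also have "\<dots> = 0"
      using column by simp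
    finally show ?thesis .
  qed
  then show ?thesis
    using carr[of "char_poly A"] by (intro eq_matI) auto
qed

lemma mat_eval_cong:
  assumes "char_poly A dvd p - q"
  shows "mat_eval n A p = mat_eval n A q"
proof -
  obtain r where "p - q = char_poly A * r"
    using assms by (rule dvdE)
  then have "p = char_poly A * r + q"
    by (simp add: diff_eq_eq)
  then show ?thesis
    using mat_eval_closed[of r] mat_eval_closed[of q]
    by (simp add: mat_eval_add mat_eval_mult cayley_hamilton)
qed

lemma strongly_clean_if_sum_mod_char_poly:
  assumes sum: "[:0, 1:] = e + u"
    and idem: "char_poly A dvd e * e - e"
    and unit: "char_poly A dvd u * v - 1"
  shows "strongly_clean_elem (ring_mat TYPE('a) n ()) A"
  unfolding strongly_clean_elem_def ring_mat_simps
proof (intro bexI conjI)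
  show "A = mat_eval n A e + mat_eval n A u"
    using mat_eval_X by (simp add: sum mat_eval_add)
  show "mat_eval n A e * mat_eval n A e = mat_eval n A e"
    using mat_eval_cong[OF idem] by (simp add: mat_eval_mult)
  show "mat_eval n A e * mat_eval n A u = mat_eval n A u * mat_eval n A e"
    by (simp add: mat_eval_mult[symmetric] mult.commute)
  have uv: "mat_eval n A u * mat_eval n A v = 1\<^sub>m n"
    using mat_eval_cong[OF unit] by (simp add: mat_eval_mult mat_eval_1)
  then have "mat_eval n A v * mat_eval n A u = 1\<^sub>m n"
    by (simp add: mat_eval_mult[symmetric] mult.commute)
  with uv show "mat_eval n A u \<in> Units (ring_mat TYPE('a) n ())"
    using mat_eval_closed[of u] mat_eval_closed[of v]
    by (auto simp: Units_def ring_mat_simps)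
  show "mat_eval n A e \<in> carrier_mat n n"
    by (rule mat_eval_closed)
qed

end

section \<open>Strong cleanness of the matrix ring\<close>

theorem theorem5:
  fixes n :: nat
  assumes "n > 0"
    and "SRC_ring n TYPE('a :: comm_ring_1)"
  shows "strongly_clean_ring (ring_mat TYPE('a) n ())"
  unfolding strongly_clean_ring_def
proof (intro conjI ballI)
  show "ring (ring_mat TYPE('a) n ())"
    by (rule ring_mat)
next
  fix A :: "'a mat"
  assume "A \<in> carrier (ring_mat TYPE('a) n ())"
  then have A: "A \<in> carrier_mat n n"
    by (simp add: ring_mat_simps)
  obtain f0 f1 where "SRC_factorization (char_poly A) f0 f1"
    using assms(2) degree_monic_char_poly[OF A] by (auto simp: SRC_ring_def)
  then obtain e0 e1 where f: "char_poly A = f0 * f1"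
    and idem: "e0 * e0 = e0" "e1 * e1 = e1"
    and unit: "poly f0 e0 dvd 1" "poly f1 e1 dvd 1"
    and uni: "unimodular_pair f0 f1"
    by (auto simp: SRC_factorization_def SR_factorization_def)
  have "1 \<in> {f0 * a + f1 * b | a b. True}"
    using uni by (simp add: unimodular_pair_def)
  then obtain a b where ab: "f0 * a + f1 * b = 1"
    by force
  obtain w0 where w0: "f0 dvd [:- e0, 1:] * w0 - 1"
    using linear_unit_mod[OF unit(1)] .
  obtain w1 where w1: "f1 dvd [:- e1, 1:] * w1 - 1"
    using linear_unit_mod[OF unit(2)] .
  have "[:e0:] * [:e0:] = [:e0:]" "[:e1:] * [:e1:] = [:e1:]"
    using idem by simp_all
  moreover have "f0 dvd ([:0, 1:] - [:e0:]) * w0 - 1" "f1 dvd ([:0, 1:] - [:e1:]) * w1 - 1"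
    using w0 w1 by simp_all
  ultimately obtain e u v where "[:0, 1:] = e + u" "f0 * f1 dvd e * e - e" "f0 * f1 dvd u * v - 1"
    by (rule idempotent_unit_sum_mod_prod[OF ab])
  then show "strongly_clean_elem (ring_mat TYPE('a) n ()) A"
    using strongly_clean_if_sum_mod_char_poly[OF A] by (simp add: f)
qed

end
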